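(* Let $T$ be a quasi-multiplication operator on a complex Banach space such that $\{1\}\subseteq\sigma(T)\subseteq\mathbb{D}\cup\{1\}$, and define the functions $m$ and $m_{\mathrm{max}}$ by $$m(\varepsilon)=\max_{\varepsilon\le|\theta|\le\pi}\frac{1}{\operatorname{dist}(e^{i\theta},\sigma(T))},\quad 0<\varepsilon\le\pi,$$ and $$m_{\mathrm{max}}(\varepsilon)=\max_{\varepsilon\le\theta\le\pi}m(\theta)\log\left(\frac{\theta}{\varepsilon}\right),\quad 0<\varepsilon\le\pi,$$ respectively. (i) Suppose that $\delta\in(0,1]$ is such that $$\min_{\varepsilon\le|\theta|\le\pi}\operatorname{dist}(e^{i\theta},\sigma(T))\le\delta\varepsilon\qquad( * )$$ for all sufficiently small $\varepsilon\in(0,\pi]$. Then $$\|T^n(I-T)\|\le(1+\delta)\,m_{\mathrm{max}}^{-1}(n)$$ for all sufficiently large $n\ge1$. (ii) Suppose that $( * )$ holds for some $\delta\in(0,1)$ and all sufficiently small $\varepsilon\in(0,\pi]$, and let $\delta'\in(\delta,1)$ and $c>1$. Then $$\|T^n(I-T)\|\ge(1-\delta')\,m_{\mathrm{max}}^{-1}(cn)$$ for all sufficiently large $n\ge1$.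
   Context: $\sigma(T)$ is the spectrum of $T$ and $\mathbb{D}=\{\lambda\in\mathbb{C}:|\lambda|<1\}$. A bounded linear operator $T$ on a complex Banach space is called a quasi-multiplication operator if $$\|f(T)\|=\sup_{\lambda\in\sigma(T)}|f(\lambda)|$$ for all rational functions $f$ which have no poles in $\sigma(T)$. For a continuous non-increasing function $\mu$ on $(0,\pi]$ with $\mu(\varepsilon)\to\infty$ as $\varepsilon\to0+$, the right-inverse $\mu^{-1}$ is defined by $\mu^{-1}(s)=\inf\{\varepsilon\in(0,\pi]:\mu(\varepsilon)\le s\}$ for $s\ge\mu(\pi)$. This is applied with $\mu=m_{\mathrm{max}}$, for which $m_{\mathrm{max}}(\pi)=0$. *)

theory Defs
  imports "HOL-Analysis.Analysis" "HOL-Computational_Algebra.Polynomial"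
begin

class complex_normed_vector = real_normed_vector +
  fixes scaleC :: "complex \<Rightarrow> 'a \<Rightarrow> 'a" (infixr "*\<^sub>C" 75)
  assumes scaleC_add_right: "a *\<^sub>C (x + y) = a *\<^sub>C x + a *\<^sub>C y"
    and scaleC_add_left: "(a + b) *\<^sub>C x = a *\<^sub>C x + b *\<^sub>C x"
    and scaleC_scaleC: "a *\<^sub>C b *\<^sub>C x = (a * b) *\<^sub>C x"
    and scaleR_eq_scaleC: "r *\<^sub>R x = complex_of_real r *\<^sub>C x"
    and norm_scaleC: "norm (a *\<^sub>C x) = cmod a * norm x"

class complex_banach = complex_normed_vector + banach

instantiation complex :: complex_banach
begin

definition scaleC_complex :: "complex \<Rightarrow> complex \<Rightarrow> complex"
  where "scaleC_complex a x = a * x"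

instance
  by standard (simp_all add: scaleC_complex_def algebra_simps norm_mult scaleR_conv_of_real)

end

definition bounded_clinear :: "('a::complex_normed_vector \<Rightarrow> 'a) \<Rightarrow> bool"
  where "bounded_clinear T \<longleftrightarrow> bounded_linear T \<and> (\<forall>c x. T (c *\<^sub>C x) = c *\<^sub>C T x)"

definition spectrum :: "('a::complex_normed_vector \<Rightarrow> 'a) \<Rightarrow> complex set"
  where "spectrum T =
    {z. \<not> (\<exists>S. bounded_clinear S \<and> S \<circ> (\<lambda>x. z *\<^sub>C x - T x) = id \<and> (\<lambda>x. z *\<^sub>C x - T x) \<circ> S = id)}"

definition poly_op :: "complex poly \<Rightarrow> ('a::complex_normed_vector \<Rightarrow> 'a) \<Rightarrow> 'a \<Rightarrow> 'a"
  where "poly_op p T x = (\<Sum>i\<le>degree p. coeff p i *\<^sub>C (T ^^ i) x)"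

text \<open>The operator \<open>f(T)\<close> for the rational function \<open>f = p/q\<close>. If \<open>q\<close> has no zeros in
  \<open>spectrum T\<close>, then \<open>q(T)\<close> is bijective, so that \<open>inv\<close> is its actual inverse.\<close>

definition rational_op ::
    "complex poly \<Rightarrow> complex poly \<Rightarrow> ('a::complex_normed_vector \<Rightarrow> 'a) \<Rightarrow> 'a \<Rightarrow> 'a"
  where "rational_op p q T = poly_op p T \<circ> inv (poly_op q T)"

text \<open>A rational function has no poles in \<open>spectrum T\<close> iff it can be written as \<open>p/q\<close>
  with \<open>q\<close> free of zeros there.\<close>

definition quasi_multiplication :: "('a::complex_banach \<Rightarrow> 'a) \<Rightarrow> bool"
  where "quasi_multiplication T \<longleftrightarrow> bounded_clinear T \<and>
    (\<forall>p q. (\<forall>z\<in>spectrum T. poly q z \<noteq> 0) \<longrightarrow>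
      onorm (rational_op p q T) = (SUP z\<in>spectrum T. cmod (poly p z / poly q z)))"

text \<open>The maxima and minima below range over compact sets of angles. For \<open>0 < \<epsilon> \<le> pi\<close>
  and a closed set \<open>S\<close> with \<open>{1} \<subseteq> S \<subseteq> ball 0 1 \<union> {1}\<close> the functions involved are
  continuous there, so the suprema and infima are attained.\<close>

definition min_dist :: "complex set \<Rightarrow> real \<Rightarrow> real"
  where "min_dist S \<epsilon> = (INF \<theta>\<in>{\<theta>. \<epsilon> \<le> \<bar>\<theta>\<bar> \<and> \<bar>\<theta>\<bar> \<le> pi}. infdist (cis \<theta>) S)"

definition m_fun :: "complex set \<Rightarrow> real \<Rightarrow> real"
  where "m_fun S \<epsilon> = (SUP \<theta>\<in>{\<theta>. \<epsilon> \<le> \<bar>\<theta>\<bar> \<and> \<bar>\<theta>\<bar> \<le> pi}. 1 / infdist (cis \<theta>) S)"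

definition m_max :: "complex set \<Rightarrow> real \<Rightarrow> real"
  where "m_max S \<epsilon> = (SUP \<theta>\<in>{\<epsilon>..pi}. m_fun S \<theta> * ln (\<theta> / \<epsilon>))"

definition right_inverse :: "(real \<Rightarrow> real) \<Rightarrow> real \<Rightarrow> real"
  where "right_inverse \<mu> s = Inf {\<epsilon> \<in> {0<..pi}. \<mu> \<epsilon> \<le> s}"

end

theory Submission
  imports Defs "HOL-Real_Asymp.Real_Asymp"
begin

text \<open>For a quasi-multiplication operator, \<open>\<parallel>T\<^sup>n(I - T)\<parallel>\<close> is the supremum of
  \<open>\<bar>z\<bar>\<^sup>n \<bar>1 - z\<bar>\<close> over \<open>z \<in> \<sigma>(T)\<close>, so both bounds are about this supremum. Write
  \<open>D = 1 / m\<close> for the minimal distance function; \<open>m_max \<epsilon> \<le> n\<close> says that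
  \<open>ln (\<theta> / \<epsilon>) \<le> n D(\<theta>)\<close> for all \<open>\<theta> \<in> [\<epsilon>, \<pi>]\<close>.

  Upper bound: a point \<open>z\<close> with argument \<open>\<theta>\<close> and \<open>x = 1 - \<bar>z\<bar>\<close> has \<open>x \<ge> D(\<theta>)\<close> and contributes
  at most \<open>exp (- n x) (\<theta> + x)\<close>; this is at most \<open>(1 + \<delta>) \<epsilon>\<close> because
  \<open>exp (- n D(\<theta>)) \<le> \<epsilon> / \<theta>\<close> and \<open>D(\<theta>) \<le> \<delta> \<theta>\<close>. Arguments bounded away from \<open>0\<close> contribute
  exponentially little, whereas \<open>\<epsilon>\<close> is at least of order \<open>1 / n\<close>.

  Lower bound: if \<open>m_max \<epsilon> > c n\<close>, there is \<open>\<theta>\<close> with \<open>exp (- c n D(\<theta>)) > \<epsilon> / \<theta>\<close>. If \<open>\<theta>\<close> is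
  small, a point \<open>z\<close> of the spectrum realising \<open>D(\<theta>)\<close> satisfies
  \<open>\<bar>z\<bar>\<^sup>n \<ge> (1 - D(\<theta>))\<^sup>n \<ge> exp (- c n D(\<theta>))\<close> and \<open>\<bar>1 - z\<bar> \<ge> (1 - \<delta>') \<theta>\<close>. Otherwise \<open>\<epsilon>\<close> is
  exponentially small, and a fixed point of the spectrum near \<open>1\<close> does better.\<close>

section \<open>The spectrum and the norm of the operators\<close>

lemma scaleC_one [simp]: "1 *\<^sub>C x = (x::'a::complex_normed_vector)"
  using scaleR_eq_scaleC[of 1 x] by simp

lemma scaleC_zero_left [simp]: "0 *\<^sub>C x = (0::'a::complex_normed_vector)"
  using scaleC_add_left[of 0 0 x] by simp

lemma scaleC_minus_left: "(- a) *\<^sub>C x = - (a *\<^sub>C (x::'a::complex_normed_vector))"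
  using scaleC_add_left[of "- a" a x] by (simp add: eq_neg_iff_add_eq_0)

lemma scaleC_diff_left: "(a - b) *\<^sub>C (x::'a::complex_normed_vector) = a *\<^sub>C x - b *\<^sub>C x"
  using scaleC_add_left[of "a - b" b x] by (simp add: algebra_simps)

lemma scaleC_diff_right: "a *\<^sub>C (x - y ::'a::complex_normed_vector) = a *\<^sub>C x - a *\<^sub>C y"
  using scaleC_add_right[of a "x - y" y] by (simp add: algebra_simps)

text \<open>The defining identity of a quasi-multiplication operator is applied to X^n - X^(n+1)
  over the constant denominator 1, whose associated operator is T^n(I - T).\<close>

lemma onorm_pow_diff_eq_SUP:
  fixes T :: "'a::complex_banach \<Rightarrow> 'a"
  assumes "quasi_multiplication T"
  shows "onorm (\<lambda>x. (T ^^ n) (x - T x)) = (SUP z\<in>spectrum T. cmod z ^ n * cmod (1 - z))"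
proof -
  define p :: "complex poly" where "p = monom 1 n - monom 1 (Suc n)"
  have lin: "linear T"
    using assms by (simp add: quasi_multiplication_def bounded_clinear_def bounded_linear.linear)
  have "linear (T ^^ n)"
    by (induction n) (simp_all only: funpow.simps linear_id linear_compose lin)
  then have diff: "(T ^^ n) (x - T x) = (T ^^ n) x - (T ^^ n) (T x)" for x
    by (rule linear_diff)
  have coeff: "coeff p i = (if i = n then 1 else if i = Suc n then -1 else 0)" for i
    by (auto simp: p_def)
  have "degree p = Suc n"
  proof (rule antisym)
    show "degree p \<le> Suc n" by (rule degree_le) (auto simp: coeff)
    show "Suc n \<le> degree p" by (rule le_degree) (auto simp: coeff)
  qed
  then have "poly_op p T x = (\<Sum>i\<in>{n, Suc n}. coeff p i *\<^sub>C (T ^^ i) x)" for x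
    unfolding poly_op_def by (intro sum.mono_neutral_right) (auto simp: coeff)
  then have "poly_op p T = (\<lambda>x. (T ^^ n) (x - T x))"
    by (auto simp: coeff scaleC_minus_left diff funpow_swap1)
  moreover have "poly_op 1 T = id"
    by (auto simp: poly_op_def)
  ultimately have "rational_op p 1 T = (\<lambda>x. (T ^^ n) (x - T x))"
    by (simp add: rational_op_def)
  moreover have "onorm (rational_op p 1 T) = (SUP z\<in>spectrum T. cmod (poly p z / poly 1 z))"
    using assms unfolding quasi_multiplication_def by force
  moreover have "cmod (poly p z / poly 1 z) = cmod z ^ n * cmod (1 - z)" for z
    by (simp add: p_def poly_monom flip: norm_power norm_mult) (simp add: algebra_simps)
  ultimately show ?thesis by simp
qed

text \<open>The resolvent set is open: if \<open>R\<close> inverts zI - T, then wI - T = (zI - T)(I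
  + A) with A = (w - z)R. For \<open>w\<close> near \<open>z\<close> the map \<open>A\<close> is a
  contraction, and I + A is inverted by Banach's fixed point theorem instead of a Neumann
  series.\<close>

lemma closed_spectrum:
  fixes T :: "'a::complex_banach \<Rightarrow> 'a"
  assumes "bounded_clinear T"
  shows "closed (spectrum T)"
proof -
  have bl: "bounded_linear T" and Tc: "T (c *\<^sub>C x) = c *\<^sub>C T x" for c x
    using assms by (auto simp: bounded_clinear_def)
  interpret T: bounded_linear T by (rule bl)
  have "\<exists>e>0. ball z e \<subseteq> - spectrum T" if z: "z \<notin> spectrum T" for z
  proof -
    obtain R where R: "bounded_clinear R" "R \<circ> (\<lambda>x. z *\<^sub>C x - T x) = id"
        "(\<lambda>x. z *\<^sub>C x - T x) \<circ> R = id"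
      using z by (auto simp: spectrum_def)
    have Rl: "R (z *\<^sub>C x - T x) = x" and Rr: "z *\<^sub>C R x - T (R x) = x" for x
      using R(2,3) by (auto simp: fun_eq_iff)
    have Rc: "R (c *\<^sub>C x) = c *\<^sub>C R x" for c x
      using R(1) by (auto simp: bounded_clinear_def)
    interpret R: bounded_linear R
      using R(1) by (auto simp: bounded_clinear_def)
    obtain K where K: "K > 0" "\<And>x. norm (R x) \<le> norm x * K"
      using R.pos_bounded by blast
    have "w \<notin> spectrum T" if w: "dist z w < 1 / (2 * K)" for w
    proof -
      define A where "A x = (w - z) *\<^sub>C R x" for x
      have A_diff: "A (x - y) = A x - A y" for x y
        by (simp add: A_def R.diff scaleC_diff_right)
      have A: "norm (A x) \<le> norm x / 2" for x
      proof -
        have "norm (A x) \<le> cmod (w - z) * (norm x * K)"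
          unfolding A_def norm_scaleC by (intro mult_left_mono K) auto
        also have "\<dots> \<le> 1 / (2 * K) * (norm x * K)"
          using w K by (intro mult_right_mono) (auto simp: dist_norm norm_minus_commute)
        finally show ?thesis using K by simp
      qed
      have factor: "R (w *\<^sub>C x - T x) = x + A x" for x
      proof -
        have "w *\<^sub>C x - T x = (z *\<^sub>C x - T x) + (w - z) *\<^sub>C x"
          by (simp add: scaleC_diff_left)
        then show ?thesis by (simp only: R.add Rl Rc A_def)
      qed
      have R_inj: "x = y" if "R x = R y" for x y
        by (metis Rr that)
      have ex: "\<exists>!x. R y - A x = x" for y
      proof (rule banach_fix_type[of "1/2"])
        have "dist (R y - A a) (R y - A b) \<le> 1/2 * dist a b" for a b
          using A[of "b - a"] by (simp add: A_diff dist_norm norm_minus_commute)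
        then show "\<forall>a b. dist (R y - A a) (R y - A b) \<le> 1/2 * dist a b" by blast
      qed auto
      \<comment> \<open>By \<open>factor\<close>, the fixed point equation reads R(wx - Tx) = Ry,
        and \<open>R\<close> can be cancelled. Unique fixed points thus become unique solutions of
        wx - Tx = y.\<close>
      have solves: "R y - A x = x \<longleftrightarrow> w *\<^sub>C x - T x = y" for x y
        using factor[of x] R_inj[of y "w *\<^sub>C x - T x"] by (auto simp: algebra_simps)
      define B where "B y = (THE x. w *\<^sub>C x - T x = y)" for y
      have ex1: "\<exists>!x. w *\<^sub>C x - T x = y" for y
        using ex[of y] by (simp add: solves)
      have B1: "w *\<^sub>C B y - T (B y) = y" for y
        unfolding B_def by (rule theI'[OF ex1])
      have B2: "B y = x" if "w *\<^sub>C x - T x = y" for x y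
        unfolding B_def by (rule the1_equality[OF ex1 that])
      have B_scaleC: "B (r *\<^sub>C x) = r *\<^sub>C B x" for r x
      proof (rule B2)
        have "w *\<^sub>C r *\<^sub>C B x - T (r *\<^sub>C B x) = r *\<^sub>C (w *\<^sub>C B x - T (B x))"
          by (simp add: Tc scaleC_diff_right scaleC_scaleC mult.commute)
        then show "w *\<^sub>C r *\<^sub>C B x - T (r *\<^sub>C B x) = r *\<^sub>C x" by (simp only: B1)
      qed
      have "bounded_linear B"
      proof (rule bounded_linear_intro)
        show "B (x + y) = B x + B y" for x y
        proof (rule B2)
          have "w *\<^sub>C (B x + B y) - T (B x + B y)
              = (w *\<^sub>C B x - T (B x)) + (w *\<^sub>C B y - T (B y))"
            by (simp add: scaleC_add_right T.add)
          then show "w *\<^sub>C (B x + B y) - T (B x + B y) = x + y" by (simp only: B1)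
        qed
        show "B (r *\<^sub>R x) = r *\<^sub>R B x" for r x
          unfolding scaleR_eq_scaleC by (rule B_scaleC)
        \<comment> \<open>The fixed point equation gives |By| \<le> K|y| + |By|/2; absorbing the
          last term yields the factor 2K.\<close>
        show "norm (B y) \<le> norm y * (2 * K)" for y
        proof -
          have "R y - A (B y) = B y" using solves[of y "B y"] B1[of y] by blast
          then have "norm (B y) \<le> norm (R y) + norm (A (B y))" by (metis norm_triangle_ineq4)
          then show ?thesis using A[of "B y"] K(2)[of y] by simp
        qed
      qed
      then have "bounded_clinear B" by (simp add: bounded_clinear_def B_scaleC)
      moreover have "B \<circ> (\<lambda>x. w *\<^sub>C x - T x) = id"
        by (rule ext) (simp add: B2)
      moreover have "(\<lambda>x. w *\<^sub>C x - T x) \<circ> B = id"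
        by (rule ext) (simp add: B1)
      ultimately show ?thesis unfolding spectrum_def by blast
    qed
    then show ?thesis using K by (intro exI[of _ "1 / (2 * K)"]) auto
  qed
  then have "open (- spectrum T)" unfolding open_contains_ball by auto
  then show ?thesis by (simp add: open_closed)
qed

section \<open>Elementary inequalities\<close>

text \<open>As a function of x, exp(-nx)(\<theta> + x) decreases once n(\<theta> + x) \<ge> 1. The
  proof replaces the derivative by 1 + u \<le> exp u with u = n(x -
  \<open>x\<^sub>0\<close>).\<close>

lemma exp_mult_add_le:
  fixes n :: real
  assumes "n > 0" "n * (\<theta> + x\<^sub>0) \<ge> 1" "x \<ge> x\<^sub>0"
  shows "exp (- n * x) * (\<theta> + x) \<le> exp (- n * x\<^sub>0) * (\<theta> + x\<^sub>0)"
proof -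
  have pos: "\<theta> + x\<^sub>0 > 0" using assms by (smt (verit) mult_nonneg_nonpos)
  have "(x - x\<^sub>0) * 1 \<le> (x - x\<^sub>0) * (n * (\<theta> + x\<^sub>0))"
    using assms by (intro mult_left_mono) auto
  then have "\<theta> + x \<le> (\<theta> + x\<^sub>0) * (1 + n * (x - x\<^sub>0))"
    by (simp add: algebra_simps)
  also have "\<dots> \<le> (\<theta> + x\<^sub>0) * exp (n * (x - x\<^sub>0))"
    using pos by (intro mult_left_mono) auto
  finally have "exp (- n * x) * (\<theta> + x) \<le> exp (- n * x) * ((\<theta> + x\<^sub>0) * exp (n * (x - x\<^sub>0)))"
    by simp
  also have "\<dots> = exp (- n * x\<^sub>0) * (\<theta> + x\<^sub>0)"
    by (simp add: algebra_simps flip: exp_add)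
  finally show ?thesis .
qed

text \<open>The right-hand side is the global maximum of the left-hand side in x, attained at x =
  1/n - \<theta>.\<close>

lemma exp_mult_add_le_max:
  fixes n :: real
  assumes "n > 0"
  shows "exp (- n * x) * (\<theta> + x) \<le> exp (n * \<theta> - 1) / n"
proof -
  have "n * (\<theta> + x) \<le> exp (n * (\<theta> + x) - 1)"
    using exp_ge_add_one_self[of "n * (\<theta> + x) - 1"] by simp
  then have "exp (- n * x) * (n * (\<theta> + x)) \<le> exp (- n * x) * exp (n * (\<theta> + x) - 1)"
    by simp
  also have "\<dots> = exp (n * \<theta> - 1)"
    by (simp add: algebra_simps flip: exp_add)
  finally show ?thesis using assms by (simp add: field_simps)
qed

text \<open>Covers the case in which the maximiser x = 1/n - \<theta> is at least \<delta>\<theta>.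
  Since 1/n \<le> e\<delta>\<epsilon>, it suffices that \<delta> exp(n\<theta>) \<le> 1 + \<delta>,
  which follows from exp(-n\<theta>) \<ge> 1 - n\<theta> \<ge> \<delta>/(1 + \<delta>).\<close>

lemma exp_max_le:
  fixes n :: real
  assumes "n > 0" "\<delta> > 0" "exp 1 * \<delta> * (n * \<epsilon>) \<ge> 1" "n * \<theta> * (1 + \<delta>) \<le> 1"
  shows "exp (n * \<theta> - 1) / n \<le> (1 + \<delta>) * \<epsilon>"
proof -
  have "1 / n \<le> exp 1 * \<delta> * \<epsilon>" using assms by (simp add: field_simps)
  then have "exp (n * \<theta> - 1) * (1 / n) \<le> exp (n * \<theta> - 1) * (exp 1 * \<delta> * \<epsilon>)"
    by (intro mult_left_mono) auto
  also have "\<dots> = \<epsilon> * (\<delta> * exp (n * \<theta>))" by (simp add: exp_diff)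
  also have "\<dots> \<le> \<epsilon> * (1 + \<delta>)"
  proof (rule mult_left_mono)
    have "1 / (1 + \<delta>) * (1 + \<delta>) = 1" using assms by simp
    then have "n * \<theta> \<le> 1 / (1 + \<delta>)" using assms by (simp add: field_simps)
    then have "1 - n * \<theta> \<ge> \<delta> / (1 + \<delta>)" using assms by (simp add: field_simps)
    moreover have "exp (- (n * \<theta>)) \<ge> 1 - n * \<theta>"
      using exp_ge_add_one_self[of "- (n * \<theta>)"] by simp
    ultimately have "\<delta> / (1 + \<delta>) * exp (n * \<theta>) \<le> exp (- (n * \<theta>)) * exp (n * \<theta>)"
      by (intro mult_right_mono) auto
    then have "\<delta> / (1 + \<delta>) * exp (n * \<theta>) \<le> 1" by (simp flip: exp_add)
    then show "\<delta> * exp (n * \<theta>) \<le> 1 + \<delta>" using assms by (simp add: field_simps)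
    have "exp 1 * \<delta> * (n * \<epsilon>) > 0" using assms by linarith
    then have "n * \<epsilon> > 0" by (rule zero_less_mult_pos) (use assms in simp)
    then have "\<epsilon> > 0" by (rule zero_less_mult_pos) (rule assms)
    then show "\<epsilon> \<ge> 0" by simp
  qed
  finally show ?thesis by (simp add: mult.commute)
qed

text \<open>The angle may be raised to \<epsilon>. If n\<epsilon> \<ge> 1, the function decreases
  from its value \<epsilon> at x = 0. Otherwise its global maximum is small enough: by
  \<open>exp_max_le\<close> if n\<epsilon>(1 + \<delta>) \<le> 1, and because it is at most 1/n in
  the remaining range.\<close>

lemma exp_mult_add_le_small_angle:
  fixes n :: real
  assumes "n > 0" "\<delta> > 0" "\<epsilon> > 0" "exp 1 * \<delta> * (n * \<epsilon>) \<ge> 1" "x \<ge> 0" "\<theta> \<le> \<epsilon>"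
  shows "exp (- n * x) * (\<theta> + x) \<le> (1 + \<delta>) * \<epsilon>"
proof -
  have "exp (- n * x) * (\<theta> + x) \<le> exp (- n * x) * (\<epsilon> + x)"
    using assms by (intro mult_left_mono) auto
  also have "\<dots> \<le> (1 + \<delta>) * \<epsilon>"
  proof -
    consider "n * \<epsilon> * (1 + \<delta>) \<le> 1" | "n * \<epsilon> \<ge> 1" | "n * \<epsilon> * (1 + \<delta>) \<ge> 1" "n * \<epsilon> \<le> 1"
      by linarith
    then show ?thesis
    proof cases
      case 1
      then show ?thesis using exp_mult_add_le_max exp_max_le assms order_trans by metis
    next
      case 2
      then have "exp (- n * x) * (\<epsilon> + x) \<le> \<epsilon>"
        using exp_mult_add_le[of n \<epsilon> 0 x] assms by simp
      also have "\<dots> \<le> (1 + \<delta>) * \<epsilon>" using assms by simp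
      finally show ?thesis .
    next
      case 3
      have "exp (- n * x) * (\<epsilon> + x) \<le> exp (n * \<epsilon> - 1) / n"
        using assms by (intro exp_mult_add_le_max)
      also have "\<dots> \<le> 1 / n" using 3 assms by (intro divide_right_mono) auto
      also have "\<dots> \<le> (1 + \<delta>) * \<epsilon>" using 3 assms by (simp add: field_simps)
      finally show ?thesis .
    qed
  qed
  finally show ?thesis .
qed

text \<open>The logarithmic hypotheses say that exp(-ny) \<le> \<epsilon>/\<theta> for y = x and for
  y = \<delta>\<theta>. The first suffices if x \<le> \<delta>\<theta>. For larger x, either the
  function is already decreasing from \<delta>\<theta> on and the second applies, or
  \<open>exp_max_le\<close> bounds its maximum.\<close>

lemma exp_mult_add_le_large_angle:
  fixes n :: real
  assumes "n > 0" "\<delta> > 0" "\<epsilon> > 0" "exp 1 * \<delta> * (n * \<epsilon>) \<ge> 1" "\<epsilon> \<le> \<theta>"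
    and "ln (\<theta> / \<epsilon>) \<le> n * x" "ln (\<theta> / \<epsilon>) \<le> n * (\<delta> * \<theta>)"
  shows "exp (- n * x) * (\<theta> + x) \<le> (1 + \<delta>) * \<epsilon>"
proof -
  have \<theta>: "\<theta> > 0" using assms by linarith
  have decay: "exp (- n * y) \<le> \<epsilon> / \<theta>" if "ln (\<theta> / \<epsilon>) \<le> n * y" for y
  proof -
    have "exp (- n * y) \<le> exp (- ln (\<theta> / \<epsilon>))" using that by simp
    also have "\<dots> = \<epsilon> / \<theta>" using \<theta> assms by (simp add: exp_minus)
    finally show ?thesis .
  qed
  have "n * (\<theta> + \<delta> * \<theta>) = n * \<theta> * (1 + \<delta>)" by (simp add: algebra_simps)
  then consider "x \<le> \<delta> * \<theta>" | "x \<ge> \<delta> * \<theta>" "n * (\<theta> + \<delta> * \<theta>) \<ge> 1" | "n * \<theta> * (1 + \<delta>) \<le> 1"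
    by linarith
  then show ?thesis
  proof cases
    case 1
    have "exp (- n * x) * (\<theta> + x) \<le> exp (- n * x) * (\<theta> + \<delta> * \<theta>)"
      using 1 by (intro mult_left_mono) auto
    also have "\<dots> \<le> \<epsilon> / \<theta> * (\<theta> + \<delta> * \<theta>)"
      using assms \<theta> decay[of x] by (intro mult_right_mono) auto
    also have "\<dots> = (1 + \<delta>) * \<epsilon>" using \<theta> by (simp add: field_simps)
    finally show ?thesis .
  next
    case 2
    have "exp (- n * x) * (\<theta> + x) \<le> exp (- n * (\<delta> * \<theta>)) * (\<theta> + \<delta> * \<theta>)"
      using 2 assms by (intro exp_mult_add_le) auto
    also have "\<dots> \<le> \<epsilon> / \<theta> * (\<theta> + \<delta> * \<theta>)"
      using assms \<theta> decay[of "\<delta> * \<theta>"] by (intro mult_right_mono) auto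
    also have "\<dots> = (1 + \<delta>) * \<epsilon>" using \<theta> by (simp add: field_simps)
    finally show ?thesis .
  next
    case 3
    then show ?thesis using exp_mult_add_le_max exp_max_le assms order_trans by metis
  qed
qed

lemma cmod_cis_minus_1: "cmod (cis \<theta> - 1) = 2 * \<bar>sin (\<theta> / 2)\<bar>"
  using dist_exp_i_1[of \<theta>] by (simp add: cis_conv_exp)

text \<open>Go from 1 to \<open>cis (Arg z)\<close>, where the chord is at most the arc, and then
  radially to \<open>z\<close>.\<close>

lemma cmod_one_minus_le: "cmod z \<le> 1 \<Longrightarrow> cmod (1 - z) \<le> \<bar>Arg z\<bar> + (1 - cmod z)"
  and cmod_cis_Arg_minus: "cmod z \<le> 1 \<Longrightarrow> cmod (cis (Arg z) - z) = 1 - cmod z"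
proof -
  assume z: "cmod z \<le> 1"
  have "cis (Arg z) - z = of_real (1 - cmod z) * cis (Arg z)"
    using rcis_cmod_Arg[of z] by (simp add: rcis_def algebra_simps)
  then show *: "cmod (cis (Arg z) - z) = 1 - cmod z"
    using z by (simp only: norm_mult norm_of_real norm_cis) simp
  have "cmod (1 - z) \<le> cmod (1 - cis (Arg z)) + cmod (cis (Arg z) - z)"
    by (metis norm_triangle_ineq diff_add_cancel add_diff_eq)
  also have "cmod (1 - cis (Arg z)) \<le> \<bar>Arg z\<bar>"
    using cmod_cis_minus_1[of "Arg z"] abs_sin_x_le_abs_x[of "Arg z / 2"]
    by (simp add: norm_minus_commute)
  finally show "cmod (1 - z) \<le> \<bar>Arg z\<bar> + (1 - cmod z)" using * by simp
qed

lemma sin_half_abs_ge: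
  assumes "0 < \<theta>" "\<theta> \<le> \<bar>\<phi>\<bar>" "\<bar>\<phi>\<bar> \<le> pi"
  shows "sin (\<theta> / 2) \<le> \<bar>sin (\<phi> / 2)\<bar>"
proof -
  have "sin (\<theta> / 2) \<le> sin (\<bar>\<phi>\<bar> / 2)" using assms by (intro sin_monotone_2pi_le) auto
  also have "\<dots> \<le> \<bar>sin (\<phi> / 2)\<bar>" by (cases "\<phi> \<ge> 0") auto
  finally show ?thesis .
qed

section \<open>Sets touching the unit circle only at 1\<close>

text \<open>Isolates what both estimates need of the spectrum; no operator occurs inside.\<close>

locale peripheral_point =
  fixes S :: "complex set"
  assumes closed: "closed S" and one_mem: "1 \<in> S" and subset: "S \<subseteq> ball 0 1 \<union> {1}"
begin

lemma cmod_le_1: "z \<in> S \<Longrightarrow> cmod z \<le> 1"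
  using subset by force

section \<open>The minimal distance function\<close>

lemma infdist_pos:
  assumes "0 < \<bar>\<theta>\<bar>" "\<bar>\<theta>\<bar> \<le> pi"
  shows "infdist (cis \<theta>) S > 0"
proof -
  have "sin (\<theta> / 2) \<noteq> 0"
    using sin_half_abs_ge[of "\<bar>\<theta>\<bar>" \<theta>] sin_gt_zero[of "\<bar>\<theta>\<bar> / 2"] assms by auto
  then have "cis \<theta> \<noteq> 1" using cmod_cis_minus_1[of \<theta>] by auto
  then have "cis \<theta> \<notin> S" using subset by force
  then show ?thesis using infdist_pos_not_in_closed[OF closed] one_mem by blast
qed

lemma min_dist_attained:
  assumes "0 < \<epsilon>" "\<epsilon> \<le> pi"
  obtains \<theta> where "\<epsilon> \<le> \<bar>\<theta>\<bar>" "\<bar>\<theta>\<bar> \<le> pi" "min_dist S \<epsilon> = infdist (cis \<theta>) S"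
    and "\<And>\<phi>. \<epsilon> \<le> \<bar>\<phi>\<bar> \<Longrightarrow> \<bar>\<phi>\<bar> \<le> pi \<Longrightarrow> min_dist S \<epsilon> \<le> infdist (cis \<phi>) S"
proof -
  let ?A = "{\<theta>. \<epsilon> \<le> \<bar>\<theta>\<bar> \<and> \<bar>\<theta>\<bar> \<le> pi}"
  have "?A = {-pi..-\<epsilon>} \<union> {\<epsilon>..pi}" using assms by auto
  then have "compact ?A" by (metis compact_Icc compact_Un)
  moreover have "?A \<noteq> {}" using assms by (auto intro!: exI[of _ \<epsilon>])
  moreover have "continuous_on ?A (\<lambda>\<theta>. infdist (cis \<theta>) S)"
    by (intro continuous_intros)
  ultimately obtain \<theta> where \<theta>: "\<theta> \<in> ?A" "\<forall>\<phi>\<in>?A. infdist (cis \<theta>) S \<le> infdist (cis \<phi>) S"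
    using continuous_attains_inf[of ?A "\<lambda>\<theta>. infdist (cis \<theta>) S"] by blast
  have "min_dist S \<epsilon> = infdist (cis \<theta>) S"
    unfolding min_dist_def by (rule cInf_eq_minimum) (use \<theta> in auto)
  then show ?thesis using \<theta> that by auto
qed

lemma min_dist_le:
  assumes "0 < \<epsilon>" "\<epsilon> \<le> \<bar>\<phi>\<bar>" "\<bar>\<phi>\<bar> \<le> pi"
  shows "min_dist S \<epsilon> \<le> infdist (cis \<phi>) S"
proof -
  have "\<epsilon> \<le> pi" using assms by linarith
  with assms(1) show ?thesis by (rule min_dist_attained) (use assms in blast)
qed

lemma min_dist_pos:
  assumes "0 < \<epsilon>" "\<epsilon> \<le> pi"
  shows "min_dist S \<epsilon> > 0"
  using assms by (rule min_dist_attained) (use assms infdist_pos in auto)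

lemma min_dist_mono:
  assumes "0 < \<epsilon>" "\<epsilon> \<le> \<theta>" "\<theta> \<le> pi"
  shows "min_dist S \<epsilon> \<le> min_dist S \<theta>"
proof -
  obtain \<phi> where "\<theta> \<le> \<bar>\<phi>\<bar>" "\<bar>\<phi>\<bar> \<le> pi" "min_dist S \<theta> = infdist (cis \<phi>) S"
    using min_dist_attained[of \<theta>] assms by auto
  then show ?thesis using min_dist_le[of \<epsilon> \<phi>] assms by simp
qed

lemma min_dist_le_one_minus_cmod:
  assumes "z \<in> S" "0 < \<epsilon>" "\<epsilon> \<le> \<bar>Arg z\<bar>"
  shows "min_dist S \<epsilon> \<le> 1 - cmod z"
proof -
  have "\<bar>Arg z\<bar> \<le> pi" using Arg_bounded[of z] by auto
  then have "min_dist S \<epsilon> \<le> infdist (cis (Arg z)) S" using assms by (intro min_dist_le)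
  also have "\<dots> \<le> dist (cis (Arg z)) z" using assms by (intro infdist_le)
  finally show ?thesis using cmod_cis_Arg_minus[OF cmod_le_1] assms by (simp add: dist_norm)
qed

text \<open>Take an angle \<phi> realising the minimum and a point of \<open>S\<close> nearest to
  \<open>cis \<phi>\<close>. Both bounds are triangle inequalities through
  \<open>cis \<phi>\<close>; as \<phi> may lie farther out than \<theta>, its chord is at least that
  of \<theta>.\<close>

lemma min_dist_witness:
  assumes "0 < \<theta>" "\<theta> \<le> pi"
  obtains z where "z \<in> S" "cmod z \<ge> 1 - min_dist S \<theta>"
    "cmod (1 - z) \<ge> 2 * sin (\<theta> / 2) - min_dist S \<theta>"
proof -
  obtain \<phi> where \<phi>: "\<theta> \<le> \<bar>\<phi>\<bar>" "\<bar>\<phi>\<bar> \<le> pi" "min_dist S \<theta> = infdist (cis \<phi>) S"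
    using assms by (rule min_dist_attained)
  obtain z where z: "z \<in> S" "infdist (cis \<phi>) S = dist (cis \<phi>) z"
    using infdist_attains_inf[OF closed, of "cis \<phi>"] one_mem by blast
  have D: "cmod (cis \<phi> - z) = min_dist S \<theta>" using z \<phi> by (simp add: dist_norm)
  show thesis
  proof
    show "cmod z \<ge> 1 - min_dist S \<theta>"
      using D norm_triangle_ineq2[of "cis \<phi>" z] by simp
    have "2 * sin (\<theta> / 2) \<le> cmod (cis \<phi> - 1)"
      unfolding cmod_cis_minus_1 using sin_half_abs_ge assms \<phi> by simp
    also have "\<dots> \<le> cmod (cis \<phi> - z) + cmod (1 - z)"
      using norm_triangle_ineq4[of "cis \<phi> - z" "1 - z"] by simp
    finally show "cmod (1 - z) \<ge> 2 * sin (\<theta> / 2) - min_dist S \<theta>" using D by simp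
  qed (use z in auto)
qed

section \<open>The functions m and m_max in terms of the minimal distance\<close>

lemma m_fun_eq:
  assumes "0 < \<epsilon>" "\<epsilon> \<le> pi"
  shows "m_fun S \<epsilon> = 1 / min_dist S \<epsilon>"
proof -
  obtain \<theta> where \<theta>: "\<epsilon> \<le> \<bar>\<theta>\<bar>" "\<bar>\<theta>\<bar> \<le> pi" "min_dist S \<epsilon> = infdist (cis \<theta>) S"
    using assms by (rule min_dist_attained)
  show ?thesis
    unfolding m_fun_def
  proof (rule cSup_eq_maximum)
    show "1 / min_dist S \<epsilon> \<in> (\<lambda>\<theta>. 1 / infdist (cis \<theta>) S) ` {\<theta>. \<epsilon> \<le> \<bar>\<theta>\<bar> \<and> \<bar>\<theta>\<bar> \<le> pi}"
      using \<theta> by auto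
    show "y \<le> 1 / min_dist S \<epsilon>"
      if "y \<in> (\<lambda>\<theta>. 1 / infdist (cis \<theta>) S) ` {\<theta>. \<epsilon> \<le> \<bar>\<theta>\<bar> \<and> \<bar>\<theta>\<bar> \<le> pi}" for y
      using that min_dist_le min_dist_pos assms by (auto intro!: frac_le)
  qed
qed

lemma m_max_eq:
  assumes "0 < \<epsilon>"
  shows "m_max S \<epsilon> = (SUP \<theta>\<in>{\<epsilon>..pi}. ln (\<theta> / \<epsilon>) / min_dist S \<theta>)"
  unfolding m_max_def using assms by (intro SUP_cong) (auto simp: m_fun_eq)

lemma ln_le_m_max_min_dist:
  assumes "0 < \<epsilon>" "\<epsilon> \<le> \<theta>" "\<theta> \<le> pi"
  shows "ln (\<theta> / \<epsilon>) \<le> m_max S \<epsilon> * min_dist S \<theta>"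
proof -
  \<comment> \<open>A real supremum dominates its family only when the family is bounded above. Here
    the numerator is largest at \<pi> and the denominator smallest at \<epsilon>.\<close>
  have "ln (\<phi> / \<epsilon>) / min_dist S \<phi> \<le> ln (pi / \<epsilon>) / min_dist S \<epsilon>" if "\<phi> \<in> {\<epsilon>..pi}" for \<phi>
    using that assms min_dist_mono[of \<epsilon> \<phi>] min_dist_pos[of \<epsilon>]
    by (intro frac_le) (auto simp: divide_right_mono)
  then have "bdd_above ((\<lambda>\<phi>. ln (\<phi> / \<epsilon>) / min_dist S \<phi>) ` {\<epsilon>..pi})"
    by (rule bdd_aboveI2)
  then have "ln (\<theta> / \<epsilon>) / min_dist S \<theta> \<le> m_max S \<epsilon>"
    unfolding m_max_eq[OF assms(1)] using assms by (intro cSUP_upper) auto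
  then show ?thesis using min_dist_pos[of \<theta>] assms by (simp add: field_simps)
qed

lemma less_m_maxE:
  assumes "0 < \<epsilon>" "\<epsilon> \<le> pi" "s < m_max S \<epsilon>"
  obtains \<theta> where "\<epsilon> \<le> \<theta>" "\<theta> \<le> pi" "s * min_dist S \<theta> < ln (\<theta> / \<epsilon>)"
proof -
  have "\<exists>\<theta>\<in>{\<epsilon>..pi}. s < ln (\<theta> / \<epsilon>) / min_dist S \<theta>"
  proof (rule ccontr)
    assume "\<not> ?thesis"
    then have "m_max S \<epsilon> \<le> s"
      unfolding m_max_eq[OF assms(1)] using assms by (intro cSUP_least) (auto simp: not_less)
    then show False using assms by simp
  qed
  then obtain \<theta> where "\<theta> \<in> {\<epsilon>..pi}" "s < ln (\<theta> / \<epsilon>) / min_dist S \<theta>" by blast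
  then show thesis
    using that[of \<theta>] min_dist_pos[of \<theta>] assms by (simp add: field_simps)
qed

text \<open>Ensures that the set whose infimum is \<open>right_inverse (m_max S) s\<close> contains
  \<pi> for every s \<ge> 0.\<close>

lemma m_max_pi: "m_max S pi = 0"
  by (simp add: m_max_def)

lemma bdd_above_pow_mult: "bdd_above ((\<lambda>z. cmod z ^ n * cmod (1 - z)) ` S)"
proof (rule bdd_aboveI2)
  fix z assume "z \<in> S"
  then have "cmod z \<le> 1" by (rule cmod_le_1)
  then have "cmod z ^ n * cmod (1 - z) \<le> 1 * (1 + 1)"
    using norm_triangle_ineq4[of 1 z] by (intro mult_mono power_le_one) auto
  then show "cmod z ^ n * cmod (1 - z) \<le> 2" by simp
qed

text \<open>Passes from \<open>z\<close> to the two real parameters of the elementary inequalities,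
  using |z| \<le> exp(-(1 - |z|)).\<close>

lemma pow_mult_le:
  assumes "z \<in> S"
  shows "cmod z ^ n * cmod (1 - z)
    \<le> exp (- real n * (1 - cmod z)) * (\<bar>Arg z\<bar> + (1 - cmod z))"
proof (rule mult_mono)
  have "cmod z \<le> exp (- (1 - cmod z))" using exp_ge_add_one_self[of "cmod z - 1"] by simp
  then have "cmod z ^ n \<le> exp (- (1 - cmod z)) ^ n" by (intro power_mono) auto
  then show "cmod z ^ n \<le> exp (- real n * (1 - cmod z))" by (simp add: exp_of_nat_mult[symmetric] algebra_simps)
qed (use assms cmod_le_1 cmod_one_minus_le in auto)

section \<open>The upper bound\<close>

lemma eventually_SUP_le:
  assumes \<delta>: "0 < \<delta>" and ev: "\<forall>\<^sub>F \<epsilon> in at_right 0. min_dist S \<epsilon> \<le> \<delta> * \<epsilon>"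
  shows "\<forall>\<^sub>F n in sequentially. (SUP z\<in>S. cmod z ^ n * cmod (1 - z))
    \<le> (1 + \<delta>) * right_inverse (m_max S) (real n)"
proof -
  obtain b where b: "b > 0" "\<And>\<theta>. 0 < \<theta> \<Longrightarrow> \<theta> < b \<Longrightarrow> min_dist S \<theta> \<le> \<delta> * \<theta>"
    using ev unfolding eventually_at_right_field by auto
  define \<theta>\<^sub>0 where "\<theta>\<^sub>0 = min (b / 2) pi"
  have \<theta>\<^sub>0: "0 < \<theta>\<^sub>0" "\<theta>\<^sub>0 \<le> pi" "\<theta>\<^sub>0 < b" using b by (auto simp: \<theta>\<^sub>0_def)
  \<comment> \<open>With this choice e\<epsilon> stays within \<open>\<theta>\<^sub>0\<close>, where
    the distance hypothesis is available, whenever \<epsilon> \<le>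
    \<open>\<epsilon>\<^sub>0\<close>.\<close>
  define \<epsilon>\<^sub>0 where "\<epsilon>\<^sub>0 = \<theta>\<^sub>0 / exp 1"
  have "\<epsilon>\<^sub>0 \<le> \<theta>\<^sub>0" using \<theta>\<^sub>0 exp_ge_add_one_self[of 1] by (simp add: \<epsilon>\<^sub>0_def field_simps)
  then have \<epsilon>\<^sub>0: "0 < \<epsilon>\<^sub>0" "\<epsilon>\<^sub>0 \<le> pi" "exp 1 * \<epsilon>\<^sub>0 = \<theta>\<^sub>0" using \<theta>\<^sub>0 by (auto simp: \<epsilon>\<^sub>0_def)
  define d where "d = min_dist S \<theta>\<^sub>0"
  have d: "d > 0" unfolding d_def using \<theta>\<^sub>0 by (intro min_dist_pos)
  \<comment> \<open>The left side bounds the contribution of angles at least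
    \<open>\<theta>\<^sub>0\<close>; the right side will be a lower bound for \<epsilon>.\<close>
  have "\<forall>\<^sub>F n in sequentially. 2 * exp (- real n * d) \<le> 1 / (exp 1 * \<delta> * real n)"
    using d \<delta> by real_asymp
  moreover have "\<forall>\<^sub>F n in sequentially. m_max S \<epsilon>\<^sub>0 \<le> real n"
    by (intro eventually_sequentiallyI[of "nat \<lceil>m_max S \<epsilon>\<^sub>0\<rceil>"]) linarith
  ultimately show ?thesis using eventually_gt_at_top[of 0]
  proof eventually_elim
    case (elim n)
    let ?a = "SUP z\<in>S. cmod z ^ n * cmod (1 - z)"
    have main: "?a \<le> (1 + \<delta>) * \<epsilon>" if \<epsilon>: "0 < \<epsilon>" "\<epsilon> \<le> \<epsilon>\<^sub>0" "m_max S \<epsilon> \<le> real n" for \<epsilon>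
    proof -
      have ln_le: "ln (\<theta> / \<epsilon>) \<le> real n * x" if "\<epsilon> \<le> \<theta>" "\<theta> \<le> pi" "min_dist S \<theta> \<le> x" for \<theta> x
      proof -
        have "ln (\<theta> / \<epsilon>) \<le> m_max S \<epsilon> * min_dist S \<theta>"
          using that \<epsilon> by (intro ln_le_m_max_min_dist)
        also have "\<dots> \<le> real n * x"
          using that \<epsilon> min_dist_pos[of \<theta>] by (intro mult_mono) auto
        finally show ?thesis .
      qed
      \<comment> \<open>At the angle e\<epsilon> the logarithm equals 1, so 1 \<le>
        n\<delta>e\<epsilon>: \<epsilon> is at least of order 1/n.\<close>
      have "exp 1 * \<epsilon> \<le> \<theta>\<^sub>0" using \<epsilon> \<epsilon>\<^sub>0 by (metis exp_ge_zero mult_left_mono)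
      moreover have "\<epsilon> \<le> exp 1 * \<epsilon>" using \<epsilon> exp_ge_add_one_self[of 1] by simp
      ultimately have "ln (exp 1 * \<epsilon> / \<epsilon>) \<le> real n * (\<delta> * (exp 1 * \<epsilon>))"
        using \<theta>\<^sub>0 \<epsilon> by (intro ln_le b(2)) auto
      then have n\<epsilon>: "exp 1 * \<delta> * (real n * \<epsilon>) \<ge> 1" using \<epsilon> by (simp add: mult_ac)
      have "cmod z ^ n * cmod (1 - z) \<le> (1 + \<delta>) * \<epsilon>" if z: "z \<in> S" for z
      proof -
        define \<theta> where "\<theta> = \<bar>Arg z\<bar>"
        define x where "x = 1 - cmod z"
        have \<theta>: "0 \<le> \<theta>" "\<theta> \<le> pi" using Arg_bounded[of z] by (auto simp: \<theta>_def)
        have x: "x \<ge> 0" using cmod_le_1[OF z] by (simp add: x_def)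
        consider "\<theta> \<le> \<epsilon>" | "\<epsilon> \<le> \<theta>" "\<theta> < \<theta>\<^sub>0" | "\<theta>\<^sub>0 \<le> \<theta>" by linarith
        then show ?thesis
        proof cases
          case 1
          have "cmod z ^ n * cmod (1 - z) \<le> exp (- real n * x) * (\<theta> + x)"
            using pow_mult_le[OF z] by (simp add: \<theta>_def x_def)
          also have "\<dots> \<le> (1 + \<delta>) * \<epsilon>"
            using 1 x elim n\<epsilon> \<delta> \<epsilon> by (intro exp_mult_add_le_small_angle) auto
          finally show ?thesis .
        next
          case 2
          have "min_dist S \<theta> \<le> x"
            using min_dist_le_one_minus_cmod[OF z, of \<theta>] 2 \<epsilon> by (simp add: \<theta>_def x_def)
          then have *: "ln (\<theta> / \<epsilon>) \<le> real n * x" "ln (\<theta> / \<epsilon>) \<le> real n * (\<delta> * \<theta>)"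
            using 2 \<theta> \<epsilon> \<theta>\<^sub>0 by (auto intro!: ln_le b(2))
          have "cmod z ^ n * cmod (1 - z) \<le> exp (- real n * x) * (\<theta> + x)"
            using pow_mult_le[OF z] by (simp add: \<theta>_def x_def)
          also have "\<dots> \<le> (1 + \<delta>) * \<epsilon>"
            using 2 * elim n\<epsilon> \<delta> \<epsilon> by (intro exp_mult_add_le_large_angle) auto
          finally show ?thesis .
        next
          case 3
          have "d \<le> x"
            using min_dist_le_one_minus_cmod[OF z, of \<theta>\<^sub>0] 3 \<theta>\<^sub>0 by (simp add: \<theta>_def x_def d_def)
          have "cmod z ^ n \<le> exp (- x) ^ n"
            using exp_ge_add_one_self[of "- x"] by (intro power_mono) (auto simp: x_def)
          also have "\<dots> = exp (- real n * x)" by (simp flip: exp_of_nat_mult)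
          also have "\<dots> \<le> exp (- real n * d)"
            using \<open>d \<le> x\<close> by (simp add: mult_left_mono)
          finally have "cmod z ^ n * cmod (1 - z) \<le> exp (- real n * d) * 2"
            using norm_triangle_ineq4[of 1 z] cmod_le_1[OF z] by (intro mult_mono) auto
          also have "\<dots> \<le> 1 / (exp 1 * \<delta> * real n)" using elim by simp
          also have "\<dots> \<le> \<epsilon>" using n\<epsilon> \<delta> elim by (simp add: field_simps)
          also have "\<dots> \<le> (1 + \<delta>) * \<epsilon>" using \<delta> \<epsilon> by simp
          finally show ?thesis .
        qed
      qed
      then show ?thesis using one_mem by (intro cSUP_least) auto
    qed
    have "?a / (1 + \<delta>) \<le> right_inverse (m_max S) (real n)"
      unfolding right_inverse_def
    proof (rule cInf_greatest)
      show "{\<epsilon> \<in> {0<..pi}. m_max S \<epsilon> \<le> real n} \<noteq> {}"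
        using m_max_pi by (auto intro!: exI[of _ pi])
    next
      fix \<epsilon> assume \<epsilon>: "\<epsilon> \<in> {\<epsilon> \<in> {0<..pi}. m_max S \<epsilon> \<le> real n}"
      \<comment> \<open>\<open>main\<close> covers only \<epsilon> \<le>
        \<open>\<epsilon>\<^sub>0\<close>. For larger \<epsilon> it is applied to
        \<open>\<epsilon>\<^sub>0\<close>, which lies in the set itself because n is large.\<close>
      have "?a \<le> (1 + \<delta>) * min \<epsilon> \<epsilon>\<^sub>0"
        using \<epsilon> \<epsilon>\<^sub>0 elim by (intro main) (auto simp: min_def)
      also have "\<dots> \<le> (1 + \<delta>) * \<epsilon>" using \<delta> by (intro mult_left_mono) auto
      finally show "?a / (1 + \<delta>) \<le> \<epsilon>" using \<delta> by (simp add: field_simps)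
    qed
    then show ?case using \<delta> by (simp add: field_simps)
  qed
qed

section \<open>The lower bound\<close>

lemma eventually_SUP_ge:
  assumes \<delta>: "0 < \<delta>" "\<delta> < \<delta>'" "\<delta>' < 1" and c: "1 < c"
    and ev: "\<forall>\<^sub>F \<epsilon> in at_right 0. min_dist S \<epsilon> \<le> \<delta> * \<epsilon>"
  shows "\<forall>\<^sub>F n in sequentially. (SUP z\<in>S. cmod z ^ n * cmod (1 - z))
    \<ge> (1 - \<delta>') * right_inverse (m_max S) (c * real n)"
proof -
  \<comment> \<open>Chosen so that k\<theta> - \<delta>\<theta> = (1 - \<delta>')\<theta>, while k <
    1 still allows k\<theta> \<le> 2 sin(\<theta>/2) for small \<theta>.\<close>
  define k where "k = 1 - \<delta>' + \<delta>"
  have k: "\<delta> < k" "k < 1" using \<delta> by (auto simp: k_def)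
  have "\<forall>\<^sub>F x::real in at_right 0. k * x \<le> 2 * sin (x / 2)"
    using k by real_asymp
  \<comment> \<open>The factor c > 1 is spent here: it reverses the usual inequality 1 - x \<le>
    exp(-x) for small x > 0.\<close>
  moreover have "\<forall>\<^sub>F x::real in at_right 0. exp (- c * x) \<le> 1 - x"
    using c by real_asymp
  ultimately have "\<forall>\<^sub>F x in at_right 0. min_dist S x \<le> \<delta> * x \<and> k * x \<le> 2 * sin (x / 2)
      \<and> exp (- c * x) \<le> 1 - x"
    using ev by eventually_elim auto
  then obtain b where b: "b > 0"
      and min_dist_le': "\<And>x. 0 < x \<Longrightarrow> x < b \<Longrightarrow> min_dist S x \<le> \<delta> * x"
      and sin_ge: "\<And>x. 0 < x \<Longrightarrow> x < b \<Longrightarrow> k * x \<le> 2 * sin (x / 2)"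
      and exp_le: "\<And>x. 0 < x \<Longrightarrow> x < b \<Longrightarrow> exp (- c * x) \<le> 1 - x"
    unfolding eventually_at_right_field by metis
  have witness: "\<exists>z\<in>S. cmod z \<ge> 1 - min_dist S \<theta> \<and> cmod (1 - z) \<ge> (1 - \<delta>') * \<theta>"
    if \<theta>: "0 < \<theta>" "\<theta> < b" "\<theta> \<le> pi" for \<theta>
  proof -
    obtain z where "z \<in> S" "cmod z \<ge> 1 - min_dist S \<theta>"
        "cmod (1 - z) \<ge> 2 * sin (\<theta> / 2) - min_dist S \<theta>"
      using \<theta>(1,3) by (rule min_dist_witness)
    then show ?thesis
      using min_dist_le'[OF \<theta>(1,2)] sin_ge[OF \<theta>(1,2)]
      by (intro bexI[of _ z]) (auto simp: k_def algebra_simps)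
  qed
  define \<theta>\<^sub>1 where "\<theta>\<^sub>1 = min (b / 2) pi"
  have \<theta>\<^sub>1: "0 < \<theta>\<^sub>1" "\<theta>\<^sub>1 \<le> pi" "\<theta>\<^sub>1 < b" using b by (auto simp: \<theta>\<^sub>1_def)
  \<comment> \<open>If the angle supplied by \<open>less_m_maxE\<close> is at least
    \<open>\<theta>\<^sub>1\<close>, then \<epsilon> \<le> \<pi>q^n. A fixed
    \<open>z\<^sub>0\<close> in \<open>S\<close> with |\<open>z\<^sub>0\<close>| > q and
    \<open>z\<^sub>0\<close> distinct from 1 eventually beats this.\<close>
  define q where "q = exp (- c * min_dist S \<theta>\<^sub>1)"
  have q: "0 < q" "q < 1" using min_dist_pos[of \<theta>\<^sub>1] \<theta>\<^sub>1 c by (auto simp: q_def)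
  obtain z\<^sub>0 where z\<^sub>0: "z\<^sub>0 \<in> S" "cmod z\<^sub>0 > q" "cmod (1 - z\<^sub>0) > 0"
  proof -
    \<comment> \<open>The cap 1 - q gives |z| \<ge> 1 - D(\<theta>) > 1 - \<theta> \<ge> q for the
      witness at \<theta>.\<close>
    define \<theta> where "\<theta> = min \<theta>\<^sub>1 (1 - q)"
    have \<theta>: "0 < \<theta>" "\<theta> < b" "\<theta> \<le> pi" "\<theta> \<le> 1 - q" using \<theta>\<^sub>1 q by (auto simp: \<theta>_def)
    obtain z where z: "z \<in> S" "cmod z \<ge> 1 - min_dist S \<theta>" "cmod (1 - z) \<ge> (1 - \<delta>') * \<theta>"
      using witness \<theta> by blast
    have "min_dist S \<theta> \<le> \<delta> * \<theta>" using min_dist_le' \<theta> by blast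
    also have "\<dots> < 1 * \<theta>" using \<delta> \<theta> by (intro mult_strict_right_mono) auto
    finally have "cmod z > q" using z \<theta> by simp
    moreover have "(1 - \<delta>') * \<theta> > 0" using \<delta> \<theta> by simp
    ultimately show ?thesis using that z by fastforce
  qed
  define r where "r = cmod z\<^sub>0"
  define t where "t = cmod (1 - z\<^sub>0)"
  have "\<forall>\<^sub>F n in sequentially. pi * q ^ n \<le> r ^ n * t"
  proof -
    have "q < r" "t > 0" using z\<^sub>0 by (auto simp: r_def t_def)
    then have "(\<lambda>n. (q / r) ^ n) \<longlonglongrightarrow> 0"
      using q by (intro LIMSEQ_power_zero) auto
    then have "\<forall>\<^sub>F n in sequentially. (q / r) ^ n < t / pi"
      using \<open>t > 0\<close> by (intro order_tendstoD) auto
    then show ?thesis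
      by eventually_elim (use \<open>q < r\<close> q in \<open>simp add: field_simps\<close>)
  qed
  then show ?thesis
  proof eventually_elim
    case (elim n)
    let ?a = "SUP z\<in>S. cmod z ^ n * cmod (1 - z)"
    have upper: "cmod z ^ n * cmod (1 - z) \<le> ?a" if "z \<in> S" for z
      using that bdd_above_pow_mult by (rule cSUP_upper)
    have main: "(1 - \<delta>') * \<epsilon> \<le> ?a" if \<epsilon>: "0 < \<epsilon>" "\<epsilon> \<le> pi" "c * real n < m_max S \<epsilon>" for \<epsilon>
    proof -
      obtain \<theta> where \<theta>: "\<epsilon> \<le> \<theta>" "\<theta> \<le> pi" "c * real n * min_dist S \<theta> < ln (\<theta> / \<epsilon>)"
        using \<epsilon> by (rule less_m_maxE)
      have \<theta>_pos: "\<theta> > 0" using \<theta> \<epsilon> by linarith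
      define D where "D = min_dist S \<theta>"
      have D: "D > 0" unfolding D_def using \<theta> \<theta>_pos by (intro min_dist_pos) auto
      have "\<epsilon> / \<theta> = exp (- ln (\<theta> / \<epsilon>))" using \<epsilon> \<theta>_pos by (simp add: exp_minus)
      also have "\<dots> \<le> exp (real n * (- c * D))" using \<theta> by (simp add: D_def algebra_simps)
      also have "\<dots> = exp (- c * D) ^ n" by (rule exp_of_nat_mult)
      finally have \<epsilon>_le: "\<epsilon> / \<theta> \<le> exp (- c * D) ^ n" .
      show ?thesis
      proof (cases "\<theta> < \<theta>\<^sub>1")
        case True
        then obtain z where z: "z \<in> S" "cmod z \<ge> 1 - D" "cmod (1 - z) \<ge> (1 - \<delta>') * \<theta>"
          using witness[of \<theta>] \<theta>\<^sub>1 \<theta>_pos \<theta> unfolding D_def by fastforce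
        have "D \<le> \<delta> * \<theta>" unfolding D_def using True \<theta>\<^sub>1 \<theta>_pos by (intro min_dist_le') auto
        also have "\<dots> \<le> 1 * \<theta>" using \<delta> \<theta>_pos by (intro mult_right_mono) auto
        finally have "exp (- c * D) \<le> 1 - D" using D True \<theta>\<^sub>1 by (intro exp_le) auto
        then have "exp (- c * D) ^ n \<le> cmod z ^ n" using z by (intro power_mono) auto
        \<comment> \<open>The power of |z| contributes \<epsilon>/\<theta> and the distance to 1
          contributes (1 - \<delta>')\<theta>, so \<theta> cancels.\<close>
        then have "\<epsilon> / \<theta> * ((1 - \<delta>') * \<theta>) \<le> cmod z ^ n * cmod (1 - z)"
          using \<epsilon>_le z \<epsilon> \<theta>_pos \<delta> by (intro mult_mono) auto
        then show ?thesis using upper[OF z(1)] \<theta>_pos by (simp add: mult.commute)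
      next
        case False
        then have "min_dist S \<theta>\<^sub>1 \<le> D" unfolding D_def using \<theta>\<^sub>1 \<theta> by (intro min_dist_mono) auto
        then have "exp (- c * D) \<le> q" using c by (simp add: q_def)
        then have "exp (- c * D) ^ n \<le> q ^ n" by (intro power_mono) auto
        then have "\<epsilon> / \<theta> \<le> q ^ n" using \<epsilon>_le by linarith
        then have "\<epsilon> \<le> \<theta> * q ^ n" using \<theta>_pos by (simp add: field_simps)
        also have "\<dots> \<le> pi * q ^ n" using \<theta> q by (intro mult_right_mono) auto
        also have "\<dots> \<le> ?a" using elim upper[OF z\<^sub>0(1)] by (simp add: r_def t_def)
        finally have "\<epsilon> \<le> ?a" .
        moreover have "(1 - \<delta>') * \<epsilon> \<le> 1 * \<epsilon>" using \<delta> \<epsilon> by (intro mult_right_mono) auto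
        ultimately show ?thesis by simp
      qed
    qed
    let ?E = "{\<epsilon> \<in> {0<..pi}. m_max S \<epsilon> \<le> c * real n}"
    have "bdd_below ?E" by (auto intro: bdd_belowI[of _ 0])
    have "pi \<in> ?E" using m_max_pi c by simp
    have "right_inverse (m_max S) (c * real n) \<le> ?a / (1 - \<delta>')"
    \<comment> \<open>Every positive \<epsilon> strictly below the infimum lies outside
      \<open>?E\<close>, so \<open>m_max S \<epsilon>\<close> exceeds cn and \<open>main\<close>
      applies. Neither continuity of \<open>m_max S\<close> nor attainment of the infimum
      enters.\<close>
    proof (rule dense_le)
      fix \<epsilon> assume \<epsilon>: "\<epsilon> < right_inverse (m_max S) (c * real n)"
      show "\<epsilon> \<le> ?a / (1 - \<delta>')"
      proof (cases "\<epsilon> > 0")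
        case True
        have "\<epsilon> < pi"
          using \<epsilon> cInf_lower[OF \<open>pi \<in> ?E\<close> \<open>bdd_below ?E\<close>] by (simp add: right_inverse_def)
        moreover have "\<epsilon> \<notin> ?E"
          using \<epsilon> cInf_lower[OF _ \<open>bdd_below ?E\<close>, of \<epsilon>] unfolding right_inverse_def by linarith
        ultimately have "(1 - \<delta>') * \<epsilon> \<le> ?a" using True by (intro main) auto
        then show ?thesis using \<delta> by (simp add: field_simps)
      next
        case False
        moreover have "?a \<ge> 0" using upper[OF one_mem] by simp
        ultimately have "\<epsilon> \<le> 0" "0 \<le> ?a / (1 - \<delta>')" using \<delta> by auto
        then show ?thesis by (rule order_trans)
      qed
    qed
    then show ?case using \<delta> by (simp add: field_simps)
  qed
qed

end

theorem theorem5p2: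
  fixes T :: "'a::complex_banach \<Rightarrow> 'a"
  assumes "quasi_multiplication T"
    and "{1} \<subseteq> spectrum T" and "spectrum T \<subseteq> ball 0 1 \<union> {1}"
  shows "(\<forall>\<delta>::real. 0 < \<delta> \<longrightarrow> \<delta> \<le> 1 \<longrightarrow>
            (\<forall>\<^sub>F \<epsilon> in at_right 0. min_dist (spectrum T) \<epsilon> \<le> \<delta> * \<epsilon>) \<longrightarrow>
            (\<forall>\<^sub>F n in sequentially.
               onorm (\<lambda>x. (T ^^ n) (x - T x))
                 \<le> (1 + \<delta>) * right_inverse (m_max (spectrum T)) (real n)))
       \<and> (\<forall>(\<delta>::real) (\<delta>'::real) (c::real). 0 < \<delta> \<longrightarrow> \<delta> < 1 \<longrightarrow>
            (\<forall>\<^sub>F \<epsilon> in at_right 0. min_dist (spectrum T) \<epsilon> \<le> \<delta> * \<epsilon>) \<longrightarrow>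
            \<delta> < \<delta>' \<longrightarrow> \<delta>' < 1 \<longrightarrow> 1 < c \<longrightarrow>
            (\<forall>\<^sub>F n in sequentially.
               onorm (\<lambda>x. (T ^^ n) (x - T x))
                 \<ge> (1 - \<delta>') * right_inverse (m_max (spectrum T)) (c * real n)))"
proof -
  interpret peripheral_point "spectrum T"
    using assms closed_spectrum by unfold_locales (auto simp: quasi_multiplication_def)
  show ?thesis
    unfolding onorm_pow_diff_eq_SUP[OF assms(1)]
    by (intro conjI allI impI eventually_SUP_le eventually_SUP_ge)
qed

end
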